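(* Let $G$ be a block graph. Then $\mathrm{gp}(G\overline{G})=n(G)+1$ if and only if $\mathrm{rad}(G)=2$ and there exists a $G$-central vertex $v$ such that $N_G(v)$ is either a clique or an independent set, and $N_G(v)$ contains at least two cut vertices of $G$.
   Context: Graphs are finite and simple; $n(G)$ is the number of vertices of $G$ and $\overline{G}$ is the complement of $G$. A graph is a block graph if every maximal 2-connected component is a clique. The complementary prism $G\overline{G}$ is the graph formed from the disjoint union of $G$ and $\overline{G}$ by adding, for each $u\in V(G)$, an edge between $u$ and the corresponding vertex $\overline{u}$ of $\overline{G}$. A geodesic is a shortest path between its two end vertices. A set $S$ of vertices of a graph $H$ is a general position set if no element of $S$ lies on a geodesic of $H$ between two other elements of $S$; $\mathrm{gp}(H)$ is the maximum cardinality of a general position set of $H$. With $d_G$ the usual shortest-path distance in $G$, the eccentricity of $u$ is $\mathrm{ecc}_G(u)=\max\{d_G(u,v): v\in V(G)\}$, $\mathrm{rad}(G)=\min\{\mathrm{ecc}_G(v): v\in V(G)\}$, and $v$ is $G$-central if $\mathrm{ecc}_G(v)=\mathrm{rad}(G)$. $N_G(v)$ is the set of neighbours of $v$ in $G$. A cut vertex of $G$ is a vertex whose removal increases the number of components.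
   Formalization: The one-vertex graph is excluded: for G = K_1 the complementary prism is K_2, so gp = 2 = n(G)+1, but rad(G) = 0, and the equivalence as stated fails. *)

theory Defs
  imports
    "Graph_Theory.Digraph_Component"
    "Graph_Theory.Shortest_Path"
begin

text \<open>
  A finite simple graph is a \<^locale>\<open>pair_graph\<close>: a finite vertex set together with a symmetric
  irreflexive set of arcs, so that each undirected edge is represented by its two orientations.
  For these, strong connectivity is ordinary connectivity.
\<close>

definition neighbourhood :: "'a pair_pre_digraph \<Rightarrow> 'a \<Rightarrow> 'a set" where
  "neighbourhood G v = {w. (v, w) \<in> parcs G}"

definition clique :: "'a pair_pre_digraph \<Rightarrow> 'a set \<Rightarrow> bool" where
  "clique G S \<longleftrightarrow> S \<subseteq> pverts G \<and> (\<forall>u\<in>S. \<forall>v\<in>S. u \<noteq> v \<longrightarrow> (u, v) \<in> parcs G)"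

definition independent_set :: "'a pair_pre_digraph \<Rightarrow> 'a set \<Rightarrow> bool" where
  "independent_set G S \<longleftrightarrow> S \<subseteq> pverts G \<and> (\<forall>u\<in>S. \<forall>v\<in>S. (u, v) \<notin> parcs G)"

definition graph_complement :: "'a pair_pre_digraph \<Rightarrow> 'a pair_pre_digraph" where
  "graph_complement G = \<lparr> pverts = pverts G,
     parcs = {(u, v). u \<in> pverts G \<and> v \<in> pverts G \<and> u \<noteq> v \<and> (u, v) \<notin> parcs G} \<rparr>"

text \<open>
  In the complementary prism, \<^term>\<open>Inl u\<close> is the copy of u in the graph itself and
  \<^term>\<open>Inr u\<close> the corresponding vertex of its complement.
\<close>

definition complementary_prism :: "'a pair_pre_digraph \<Rightarrow> ('a + 'a) pair_pre_digraph" where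
  "complementary_prism G = \<lparr> pverts = pverts G <+> pverts (graph_complement G),
     parcs = {(Inl u, Inl v) |u v. (u, v) \<in> parcs G}
       \<union> {(Inr u, Inr v) |u v. (u, v) \<in> parcs (graph_complement G)}
       \<union> {(Inl u, Inr u) |u. u \<in> pverts G}
       \<union> {(Inr u, Inl u) |u. u \<in> pverts G} \<rparr>"

text \<open>
  The number of vertices is required to be at least three, as usual for 2-connectedness. Counting
  single vertices and single edges as 2-connected as well would not affect the notion of a block
  graph below, because the additional maximal subgraphs are cliques anyway.
\<close>

definition two_connected :: "('a, 'b) pre_digraph \<Rightarrow> bool" where
  "two_connected H \<longleftrightarrow> graph H \<and> card (verts H) \<ge> 3 \<and> connected H
     \<and> (\<forall>v\<in>verts H. connected (pre_digraph.del_vert H v))"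

definition block_graph :: "'a pair_pre_digraph \<Rightarrow> bool" where
  "block_graph G \<longleftrightarrow>
     (\<forall>H. pre_digraph.max_subgraph (with_proj G) two_connected H \<longrightarrow> clique G (verts H))"

definition geodesic :: "'a pair_pre_digraph \<Rightarrow> 'a \<Rightarrow> ('a \<times> 'a) awalk \<Rightarrow> 'a \<Rightarrow> bool" where
  "geodesic G u p v \<longleftrightarrow> pre_digraph.apath (with_proj G) u p v
     \<and> (\<forall>q. pre_digraph.apath (with_proj G) u q v \<longrightarrow> length p \<le> length q)"

definition general_position_set :: "'a pair_pre_digraph \<Rightarrow> 'a set \<Rightarrow> bool" where
  "general_position_set G S \<longleftrightarrow> S \<subseteq> pverts G
     \<and> (\<forall>x\<in>S. \<forall>y\<in>S. \<forall>z\<in>S. x \<noteq> y \<and> z \<noteq> x \<and> z \<noteq> y \<longrightarrow>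
          (\<forall>p. geodesic G x p y \<longrightarrow> z \<notin> set (pre_digraph.awalk_verts (with_proj G) x p)))"

definition gp_number :: "'a pair_pre_digraph \<Rightarrow> nat" where
  "gp_number G = Max {card S |S. general_position_set G S}"

text \<open>
  Distances are extended reals; vertices in different components are at distance \<open>\<infinity>\<close>, so
  a disconnected graph has infinite radius.
\<close>

definition graph_dist :: "'a pair_pre_digraph \<Rightarrow> 'a \<Rightarrow> 'a \<Rightarrow> ereal" where
  "graph_dist G u v = wf_digraph.\<mu> (with_proj G) (\<lambda>_. 1) u v"

definition eccentricity :: "'a pair_pre_digraph \<Rightarrow> 'a \<Rightarrow> ereal" where
  "eccentricity G u = Max {graph_dist G u v |v. v \<in> pverts G}"

definition radius :: "'a pair_pre_digraph \<Rightarrow> ereal" where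
  "radius G = Min {eccentricity G v |v. v \<in> pverts G}"

definition central :: "'a pair_pre_digraph \<Rightarrow> 'a \<Rightarrow> bool" where
  "central G v \<longleftrightarrow> v \<in> pverts G \<and> eccentricity G v = radius G"

definition num_components :: "('a, 'b) pre_digraph \<Rightarrow> nat" where
  "num_components H = card (pre_digraph.sccs_verts H)"

definition cut_vertex :: "'a pair_pre_digraph \<Rightarrow> 'a \<Rightarrow> bool" where
  "cut_vertex G v \<longleftrightarrow> v \<in> pverts G
     \<and> num_components (pre_digraph.del_vert (with_proj G) v) > num_components (with_proj G)"

lemma pair_graph_complement:
  assumes "pair_graph G"
  shows "pair_graph (graph_complement G)"
proof -
  interpret pair_graph G by fact
  have fin: "finite (parcs (graph_complement G))"
    by (rule finite_subset[of _ "pverts G \<times> pverts G"])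
       (auto simp: graph_complement_def pair_finite_verts)
  show ?thesis
    using fin pair_finite_verts pair_sym_arcs
    by unfold_locales (auto simp: graph_complement_def symmetric_def sym_def)
qed

lemma pair_graph_complementary_prism:
  assumes "pair_graph G"
  shows "pair_graph (complementary_prism G)"
proof -
  interpret pair_graph G by fact
  interpret C: pair_graph "graph_complement G" by (rule pair_graph_complement[OF assms])
  have V: "pverts (graph_complement G) = pverts G"
    by (simp add: graph_complement_def)
  let ?P = "complementary_prism G"
  have wf: "parcs ?P \<subseteq> pverts ?P \<times> pverts ?P"
    using V by (auto simp: complementary_prism_def dest: in_arcsD1 in_arcsD2 C.in_arcsD1 C.in_arcsD2)
  have finV: "finite (pverts ?P)"
    by (simp add: complementary_prism_def V pair_finite_verts)
  have finA: "finite (parcs ?P)"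
    by (rule finite_subset[OF wf]) (simp add: finV)
  have sym: "sym (parcs ?P)"
    using pair_sym_arcs C.pair_sym_arcs
    by (auto simp: complementary_prism_def symmetric_def sym_def)
  have irr: "fst e \<noteq> snd e" if "e \<in> parcs ?P" for e
    using that pair_no_loops C.pair_no_loops by (fastforce simp: complementary_prism_def)
  show ?thesis
    using wf finV finA sym irr by unfold_locales (auto simp: symmetric_def)
qed

end

theory Submission
  imports Defs
begin

text \<open>
  All distances in the prism are at most three, so geodesics can be classified explicitly. If a set
  in general position contains both copies of a vertex v, its other elements are copies in the
  complement of neighbours of v and copies in G of non-neighbours of v. Hence at most one vertex
  contributes both copies, at most n + 1 elements are possible, and n + 1 is attained only by the
  set consisting of the copies in G of all vertices outside N(v) and the copies in the complement
  of N[v].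

  The geodesics of the prism show that this set is in general position only if v has eccentricity
  at most two, no vertex of N(v) is adjacent to all vertices outside N[v], and N(v) does not
  contain an edge together with a vertex adjacent to neither end. In a block graph, where
  4-cycles and 5-cycles are cliques, every vertex at distance two from v has a unique neighbour
  in N(v), shared by adjacent such vertices. This makes the conditions sufficient, turns the second
  one into the existence of two cut vertices in N(v) and the third one into N(v) being a
  clique or independent.
\<close>

section \<open>Geodesics of length at most three and distances up to two\<close>

text \<open>
  For x, y at distance at most three this says that z is an inner vertex of a geodesic from x to y.
\<close>

definition short_between :: "'a pair_pre_digraph \<Rightarrow> 'a \<Rightarrow> 'a \<Rightarrow> 'a \<Rightarrow> bool" where
  "short_between G x z y \<longleftrightarrow> (x, y) \<notin> parcs G \<and>
     ((x, z) \<in> parcs G \<and> (z, y) \<in> parcs G \<or>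
      (\<nexists>w. (x, w) \<in> parcs G \<and> (w, y) \<in> parcs G) \<and>
      (\<exists>w. (x, z) \<in> parcs G \<and> (z, w) \<in> parcs G \<and> (w, y) \<in> parcs G \<or>
           (x, w) \<in> parcs G \<and> (w, z) \<in> parcs G \<and> (z, y) \<in> parcs G))"

context pair_wf_digraph
begin

lemma apath_arcI: "(x, y) \<in> parcs G \<Longrightarrow> x \<noteq> y \<Longrightarrow> apath x [(x, y)] y"
  by (auto simp: apath_simps in_arcsD2)

lemma apath_arcs2I:
  "(x, z) \<in> parcs G \<Longrightarrow> (z, y) \<in> parcs G \<Longrightarrow> distinct [x, z, y] \<Longrightarrow> apath x [(x, z), (z, y)] y"
  by (auto simp: apath_simps in_arcsD2)

lemma apath_arcs3I:
  "(x, z) \<in> parcs G \<Longrightarrow> (z, w) \<in> parcs G \<Longrightarrow> (w, y) \<in> parcs G \<Longrightarrow> distinct [x, z, w, y] \<Longrightarrow>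
   apath x [(x, z), (z, w), (w, y)] y"
  by (auto simp: apath_simps in_arcsD2)

lemma awalk_length_ge_2:
  assumes "awalk x q y" "x \<noteq> y" "(x, y) \<notin> parcs G"
  shows "2 \<le> length q"
proof (rule ccontr)
  assume "\<not> 2 \<le> length q"
  then consider "q = []" | a where "q = [a]"
    by (cases q rule: list_exhaust_NSC) auto
  then show False
    using assms by cases (auto simp: awalk_simps)
qed

lemma awalk_length_ge_3:
  assumes "awalk x q y" "x \<noteq> y" "(x, y) \<notin> parcs G"
    and "\<nexists>w. (x, w) \<in> parcs G \<and> (w, y) \<in> parcs G"
  shows "3 \<le> length q"
proof (rule ccontr)
  assume "\<not> 3 \<le> length q"
  then have "length q = Suc (Suc 0)"
    using awalk_length_ge_2[OF assms(1-3)] by simp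
  then obtain a b where "q = [a, b]"
    by (auto simp: length_Suc_conv)
  then show False
    using assms by (cases a; cases b) (auto simp: awalk_simps)
qed

text \<open>A path with at most three arcs from \<open>x\<close> to \<open>y\<close> bounds every
  geodesic, so one with an inner vertex has two or three arcs and can be written out. Conversely, a
  written-out path is shortest, because nonadjacency forces two arcs on every walk and the lack of a
  common neighbour forces three.\<close>

lemma geodesic_through_iff:
  assumes "x \<noteq> y" "z \<noteq> x" "z \<noteq> y" and short: "apath x q y" "length q \<le> 3"
  shows "(\<exists>p. geodesic G x p y \<and> z \<in> set (awalk_verts x p)) \<longleftrightarrow> short_between G x z y"
proof
  assume "\<exists>p. geodesic G x p y \<and> z \<in> set (awalk_verts x p)"
  then obtain p where p: "apath x p y" "z \<in> set (awalk_verts x p)"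
    and min: "\<And>q. apath x q y \<Longrightarrow> length p \<le> length q"
    by (auto simp: geodesic_def)
  have "length p \<le> 3"
    using min[OF short(1)] short(2) by simp
  moreover have "length p \<noteq> 0" "length p \<noteq> 1"
    using p assms(1-3) by (auto simp: length_Suc_conv apath_simps)
  ultimately consider "length p = Suc (Suc 0)" | "length p = Suc (Suc (Suc 0))"
    by linarith
  then show "short_between G x z y"
  proof cases
    case 1
    then obtain a b where ab: "p = [a, b]"
      by (auto simp: length_Suc_conv)
    have "(x, y) \<notin> parcs G"
      using min[OF apath_arcI[OF _ assms(1)]] ab by auto
    then show ?thesis
      using p ab assms(1-3) by (cases a; cases b) (auto simp: short_between_def apath_simps)
  next
    case 2
    then obtain a b c where abc: "p = [a, b, c]"
      by (auto simp: length_Suc_conv)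
    have no1: "(x, y) \<notin> parcs G"
      using min[OF apath_arcI[OF _ assms(1)]] abc by auto
    \<comment> \<open>A common neighbour would give a path with two arcs, shorter than
      \<open>p\<close>.\<close>
    moreover have "\<not> ((x, w) \<in> parcs G \<and> (w, y) \<in> parcs G)" for w
    proof
      assume w: "(x, w) \<in> parcs G \<and> (w, y) \<in> parcs G"
      then have "distinct [x, w, y]"
        using assms(1) no1 by auto
      then show False
        using min[OF apath_arcs2I[of x w y]] w abc by simp
    qed
    ultimately show ?thesis
      using p abc assms(1-3) by (cases a; cases b; cases c) (auto simp: short_between_def apath_simps)
  qed
next
  assume sb: "short_between G x z y"
  then have nadj: "(x, y) \<notin> parcs G"
    by (simp add: short_between_def)
  have len2: "Suc (Suc 0) \<le> length q" if "apath x q y" for q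
    using awalk_length_ge_2[OF awalkI_apath[OF that] \<open>x \<noteq> y\<close> nadj] by simp
  from sb consider "(x, z) \<in> parcs G" "(z, y) \<in> parcs G"
    | w where "\<nexists>w. (x, w) \<in> parcs G \<and> (w, y) \<in> parcs G"
        "(x, z) \<in> parcs G" "(z, w) \<in> parcs G" "(w, y) \<in> parcs G"
    | w where "\<nexists>w. (x, w) \<in> parcs G \<and> (w, y) \<in> parcs G"
        "(x, w) \<in> parcs G" "(w, z) \<in> parcs G" "(z, y) \<in> parcs G"
    by (auto simp: short_between_def)
  then show "\<exists>p. geodesic G x p y \<and> z \<in> set (awalk_verts x p)"
  proof cases
    case 1
    then have "geodesic G x [(x, z), (z, y)] y"
      using assms(1-3) len2 by (auto simp: geodesic_def intro!: apath_arcs2I)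
    then show ?thesis by (intro exI[of _ "[(x, z), (z, y)]"]) simp
  next
    case 2
    have "distinct [x, z, w, y]"
      using 2 assms(1-3) nadj by auto
    moreover have "Suc (Suc (Suc 0)) \<le> length q" if "apath x q y" for q
      using awalk_length_ge_3[OF awalkI_apath[OF that] \<open>x \<noteq> y\<close> nadj 2(1)] by simp
    ultimately have "geodesic G x [(x, z), (z, w), (w, y)] y"
      using 2 by (auto simp: geodesic_def intro!: apath_arcs3I)
    then show ?thesis by (intro exI[of _ "[(x, z), (z, w), (w, y)]"]) simp
  next
    case 3
    have "distinct [x, w, z, y]"
      using 3 assms(1-3) nadj by auto
    moreover have "Suc (Suc (Suc 0)) \<le> length q" if "apath x q y" for q
      using awalk_length_ge_3[OF awalkI_apath[OF that] \<open>x \<noteq> y\<close> nadj 3(1)] by simp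
    ultimately have "geodesic G x [(x, w), (w, z), (z, y)] y"
      using 3 by (auto simp: geodesic_def intro!: apath_arcs3I)
    then show ?thesis by (intro exI[of _ "[(x, w), (w, z), (z, y)]"]) simp
  qed
qed

text \<open>With diameter at most three, general position becomes a condition on adjacency alone,
  which makes case analysis in the prism possible.\<close>

lemma general_position_set_iff_short_between:
  assumes "\<And>x y. x \<in> pverts G \<Longrightarrow> y \<in> pverts G \<Longrightarrow> \<exists>q. apath x q y \<and> length q \<le> 3"
  shows "general_position_set G S \<longleftrightarrow> S \<subseteq> pverts G \<and>
    (\<forall>x\<in>S. \<forall>y\<in>S. \<forall>z\<in>S. x \<noteq> y \<and> z \<noteq> x \<and> z \<noteq> y \<longrightarrow> \<not> short_between G x z y)"
proof -
  have through: "(\<forall>p. geodesic G x p y \<longrightarrow> z \<notin> set (awalk_verts x p)) \<longleftrightarrow> \<not> short_between G x z y"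
    if "S \<subseteq> pverts G" "x \<in> S" "y \<in> S" "x \<noteq> y" "z \<noteq> x" "z \<noteq> y" for x y z
  proof -
    obtain q where "apath x q y" "length q \<le> 3"
      using assms[of x y] \<open>S \<subseteq> pverts G\<close> \<open>x \<in> S\<close> \<open>y \<in> S\<close> by auto
    from geodesic_through_iff[OF that(4-6) this, symmetric] show ?thesis
      by (simp only: not_ex de_Morgan_conj imp_conv_disj)
  qed
  show ?thesis
    unfolding general_position_set_def awalk_verts_with_proj_eq
    by (intro conj_cong[OF refl] ball_cong[OF refl] imp_cong[OF refl] through) simp_all
qed

lemma awalk_cost_unit: "awalk_cost (\<lambda>_. 1) p = real (length p)"
  by (induction p) auto

lemma graph_dist_le:
  assumes "awalk u p v" shows "graph_dist G u v \<le> real (length p)"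
  using min_cost_le_walk_cost[OF assms, of "\<lambda>_. 1"] by (simp add: graph_dist_def awalk_cost_unit)

text \<open>The distance is an infimum over walks; if there is no walk it is infinite, so
  unreachable vertices are covered too.\<close>

lemma graph_dist_geI:
  assumes "\<And>p. awalk u p v \<Longrightarrow> n \<le> length p" shows "ereal (real n) \<le> graph_dist G u v"
  unfolding graph_dist_def \<mu>_def awalk_cost_unit using assms by (auto intro!: INF_greatest)

lemma graph_dist_le_2_iff:
  assumes "u \<in> pverts G"
  shows "graph_dist G u v \<le> 2 \<longleftrightarrow>
    u = v \<or> (u, v) \<in> parcs G \<or> (\<exists>w. (u, w) \<in> parcs G \<and> (w, v) \<in> parcs G)" (is "_ \<longleftrightarrow> ?R")
proof
  assume le: "graph_dist G u v \<le> 2"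
  show ?R
  proof (rule ccontr)
    assume "\<not> ?R"
    then have "ereal (real 3) \<le> graph_dist G u v"
      by (intro graph_dist_geI awalk_length_ge_3) auto
    from order_trans[OF this le] show False
      by simp
  qed
next
  assume ?R
  then obtain p where "awalk u p v" "length p \<le> 2"
  proof (elim disjE exE conjE)
    assume "u = v" then show thesis using that[of "[]"] assms by (simp add: awalk_simps)
  next
    assume "(u, v) \<in> parcs G" then show thesis
      using that[of "[(u, v)]"] by (simp add: awalk_simps in_arcsD2)
  next
    fix w assume "(u, w) \<in> parcs G" "(w, v) \<in> parcs G" then show thesis
      using that[of "[(u, w), (w, v)]"] by (simp add: awalk_simps in_arcsD2)
  qed
  then have "graph_dist G u v \<le> ereal (real (length p))" "ereal (real (length p)) \<le> 2"
    using graph_dist_le by auto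
  then show "graph_dist G u v \<le> 2" by (rule order_trans)
qed

lemma graph_dist_ge_2:
  assumes "u \<noteq> v" "(u, v) \<notin> parcs G"
  shows "2 \<le> graph_dist G u v"
  using graph_dist_geI[of u v 2] awalk_length_ge_2[OF _ assms] by simp

lemma arc_in_induce_subgraph:
  "(a, b) \<in> arcs_ends (with_proj G \<restriction> S) \<longleftrightarrow> (a, b) \<in> parcs G \<and> a \<in> S \<and> b \<in> S"
  by (auto simp: arcs_ends_conv)

lemma del_vert_induce_subgraph:
  "pre_digraph.del_vert (with_proj G \<restriction> S) v = with_proj G \<restriction> (S - {v})"
  by (auto simp: pre_digraph.del_vert_def induce_subgraph_def)

lemma del_vert_eq_induce_subgraph: "del_vert v = with_proj G \<restriction> (pverts G - {v})"
  by (auto simp: pre_digraph.del_vert_def induce_subgraph_def dest: in_arcsD1 in_arcsD2)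

end

section \<open>Counting components by reachability\<close>

lemma (in sym_digraph) num_components_eq_1I:
  assumes "r \<in> verts G" "\<And>w. w \<in> verts G \<Longrightarrow> r \<rightarrow>\<^sup>* w"
  shows "num_components G = 1"
proof -
  have "scc_of w = scc_of r" if "w \<in> verts G" for w
    using assms(2)[OF that] by (intro scc_of_eq scc_ofI_reachable')
  then have "scc_of ` verts G = {scc_of r}"
    using assms(1) by blast
  then have "sccs_verts = {scc_of r}"
    by (simp add: sccs_verts_conv_scc_of)
  then show ?thesis by (simp add: num_components_def)
qed

text \<open>Failure of reachability in one direction already separates two strong
  components.\<close>

lemma (in fin_digraph) num_components_gt_1I:
  assumes "a \<in> verts G" "b \<in> verts G" "\<not> a \<rightarrow>\<^sup>* b"
  shows "num_components G > 1"
proof -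
  have "b \<in> scc_of b" "b \<notin> scc_of a"
    using in_scc_of_self[OF assms(2)] assms(3) by (simp_all add: scc_of_def)
  then have "scc_of a \<noteq> scc_of b"
    by metis
  then have "card {scc_of a, scc_of b} = 2"
    by simp
  moreover have "{scc_of a, scc_of b} \<subseteq> sccs_verts"
    using assms(1,2) by (simp add: sccs_verts_conv_scc_of)
  then have "card {scc_of a, scc_of b} \<le> num_components G"
    unfolding num_components_def by (rule card_mono[OF finite_sccs_verts])
  ultimately show ?thesis
    by linarith
qed

section \<open>Connected induced subgraphs, and cycles in block graphs\<close>

context pair_graph
begin

lemma graph_induce_subgraph:
  assumes "S \<subseteq> pverts G" shows "graph (with_proj G \<restriction> S)"
proof -
  have "induced_subgraph (with_proj G \<restriction> S) (with_proj G)"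
    using assms by (intro induced_induce) auto
  then show ?thesis
    by (intro digraph.graphI digraph_subgraph induced_imp_subgraph
        induced_graph_imp_symmetric[OF pair_sym_arcs])
qed

lemma connected_induce_singleton: "a \<in> pverts G \<Longrightarrow> connected (with_proj G \<restriction> {a})"
  by (auto simp: connected_def strongly_connected_def reachable_def)

lemma connected_induce_insert:
  assumes "connected (with_proj G \<restriction> S)" "S \<subseteq> pverts G" "a \<in> S" "(a, b) \<in> parcs G"
  shows "connected (with_proj G \<restriction> insert b S)"
proof -
  have b: "b \<in> pverts G" using assms(4) by (rule in_arcsD2)
  interpret S: graph "with_proj G \<restriction> S"
    using assms(2) by (rule graph_induce_subgraph)
  interpret T: graph "with_proj G \<restriction> insert b S"
    using assms(2) b by (intro graph_induce_subgraph) auto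
  \<comment> \<open>\<open>connected\<close> refers to the symmetric closure, which has the same
    reachability relation here since the induced subgraph is symmetric.\<close>
  have "u \<rightarrow>\<^sup>*\<^bsub>with_proj G \<restriction> S\<^esub> v" if "u \<in> S" "v \<in> S" for u v
    using assms(1) that S.reachable_mk_symmetric_eq[OF S.sym_arcs]
    by (auto simp: connected_def strongly_connected_def)
  then have uv: "u \<rightarrow>\<^sup>*\<^bsub>with_proj G \<restriction> insert b S\<^esub> v" if "u \<in> S" "v \<in> S" for u v
    using that by (blast intro: reachable_induce_ss)
  have ab: "(a, b) \<in> arcs_ends (with_proj G \<restriction> insert b S)"
    using assms(3,4) by (simp add: arc_in_induce_subgraph)
  have ub: "u \<rightarrow>\<^sup>*\<^bsub>with_proj G \<restriction> insert b S\<^esub> b" if "u \<in> S" for u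
    using uv[OF that assms(3)] ab by (rule T.reachable_adj_trans)
  have bu: "b \<rightarrow>\<^sup>*\<^bsub>with_proj G \<restriction> insert b S\<^esub> u" if "u \<in> S" for u
    using symmetric_reachable[OF T.sym_arcs ub[OF that]] .
  have "u \<rightarrow>\<^sup>*\<^bsub>with_proj G \<restriction> insert b S\<^esub> v" if "u \<in> insert b S" "v \<in> insert b S" for u v
    using that uv ub bu T.reachable_refl[of b] by auto
  then show ?thesis
    using T.reachable_mk_symmetric_eq[OF T.sym_arcs] by (auto intro!: T.connectedI)
qed

lemma connected_induce_path:
  "\<lbrakk>xs \<noteq> []; set xs \<subseteq> pverts G; successively (\<lambda>a b. (a, b) \<in> parcs G) xs\<rbrakk> \<Longrightarrow>
   connected (with_proj G \<restriction> set xs)"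
proof (induction xs rule: induct_list012)
  case (2 x)
  then show ?case by (simp add: connected_induce_singleton)
next
  case (3 x y zs)
  then have "connected (with_proj G \<restriction> insert x (set (y # zs)))"
    by (intro connected_induce_insert[of _ y]) (auto intro: arcs_symmetric)
  then show ?case by simp
qed simp

text \<open>Deleting a vertex from a cycle leaves a path: the part after it, then the closing edge,
  then the part before it. Chords only add arcs to the induced subgraph.\<close>

lemma two_connected_induce_cycle:
  assumes "distinct xs" "3 \<le> length xs" "set xs \<subseteq> pverts G"
    and adj: "successively (\<lambda>a b. (a, b) \<in> parcs G) xs" "(last xs, hd xs) \<in> parcs G"
  shows "two_connected (with_proj G \<restriction> set xs)"
proof -
  let ?adj = "\<lambda>a b. (a, b) \<in> parcs G"
  have "connected (with_proj G \<restriction> (set xs - {v}))" if "v \<in> set xs" for v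
  proof -
    obtain as bs where xs: "xs = as @ v # bs"
      using \<open>v \<in> set xs\<close> by (auto simp: in_set_conv_decomp)
    have "successively ?adj as" "successively ?adj (v # bs)"
      using adj(1) by (auto simp: xs successively_append_iff)
    then have "successively ?adj (bs @ as)"
      using adj(2) by (cases as) (auto simp: xs successively_append_iff successively_Cons split: if_splits)
    moreover have "set xs - {v} = set (bs @ as)"
      using assms(1) by (auto simp: xs)
    moreover have "bs @ as \<noteq> []" "set (bs @ as) \<subseteq> pverts G"
      using assms(2,3) by (auto simp: xs)
    ultimately show ?thesis
      using connected_induce_path[of "bs @ as"] by simp
  qed
  then show ?thesis
    using assms by (auto simp: two_connected_def graph_induce_subgraph distinct_card
        del_vert_induce_subgraph intro!: connected_induce_path)
qed

text \<open>\<open>block_graph\<close> speaks of maximal 2-connected subgraphs only. By finiteness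
  every 2-connected subgraph can be enlarged to a maximal one; the induction is on the number of
  vertices and arcs still missing from it.\<close>

lemma two_connected_imp_clique:
  assumes "block_graph G" "two_connected H" "subgraph H (with_proj G)"
  shows "clique G (verts H)"
  using assms(2,3)
proof (induction "card (pverts G) + card (parcs G) - (card (verts H) + card (arcs H))"
    arbitrary: H rule: less_induct)
  case (less H)
  show ?case
  proof (cases "max_subgraph two_connected H")
    case True
    then show ?thesis using assms(1) by (simp add: block_graph_def)
  next
    case False
    then obtain K where K: "K \<noteq> H" "subgraph H K" "subgraph K (with_proj G)" "two_connected K"
      using less.prems by (auto simp: max_subgraph_def)
    have fin: "finite (verts K)" "finite (arcs K)"
      using fin_digraph.finite_verts fin_digraph.finite_arcs fin_digraph_subgraph[OF K(3)] by blast+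
    have sub: "verts H \<subseteq> verts K" "arcs H \<subseteq> arcs K" "verts K \<subseteq> pverts G" "arcs K \<subseteq> parcs G"
      using subgraphE[OF K(2)] subgraphE[OF K(3)] by auto
    \<comment> \<open>Compatibility fixes the \<open>tail\<close> and \<open>head\<close> maps, so
      distinct subgraphs must differ in their vertices or arcs.\<close>
    have "verts H \<noteq> verts K \<or> arcs H \<noteq> arcs K"
      using K(1,2) by (auto simp: subgraph_def compatible_def)
    then have "card (verts H) + card (arcs H) < card (verts K) + card (arcs K)"
      using sub fin psubset_card_mono[of "verts K" "verts H"] psubset_card_mono[of "arcs K" "arcs H"]
        card_mono[of "verts K" "verts H"] card_mono[of "arcs K" "arcs H"]
      by (metis add_less_le_mono add_le_less_mono psubsetI)
    moreover have "card (verts K) + card (arcs K) \<le> card (pverts G) + card (parcs G)"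
      using sub by (intro add_mono card_mono) auto
    ultimately have "clique G (verts K)"
      by (intro less.hyps K) auto
    then show ?thesis
      using sub by (auto simp: clique_def)
  qed
qed

lemma block_graph_cycle_clique:
  assumes "block_graph G" "distinct xs" "3 \<le> length xs"
    and "successively (\<lambda>a b. (a, b) \<in> parcs G) xs" "(last xs, hd xs) \<in> parcs G"
    and "a \<in> set xs" "b \<in> set xs" "a \<noteq> b"
  shows "(a, b) \<in> parcs G"
proof -
  \<comment> \<open>Each vertex of the list is the tail of an arc: to its successor or, for the last
    one, to the head of the list.\<close>
  have "set xs \<subseteq> pverts G"
  proof
    fix v assume "v \<in> set xs"
    then obtain as bs where xs: "xs = as @ v # bs"
      by (auto simp: in_set_conv_decomp)
    show "v \<in> pverts G"
    proof (cases bs)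
      case Nil then show ?thesis using assms(5) xs by (auto dest: in_arcsD1)
    next
      case (Cons c cs) then show ?thesis using assms(4) xs
        by (auto simp: successively_append_iff dest: in_arcsD1)
    qed
  qed
  then have "clique G (set xs)"
    using two_connected_imp_clique[OF assms(1) two_connected_induce_cycle subgraph_induce_subgraphI] assms
    by simp
  then show ?thesis using assms by (auto simp: clique_def)
qed

end

section \<open>General position in the complementary prism\<close>

lemma complementary_prism_simps:
  "(Inl u, Inl v) \<in> parcs (complementary_prism G) \<longleftrightarrow> (u, v) \<in> parcs G"
  "(Inr u, Inr v) \<in> parcs (complementary_prism G) \<longleftrightarrow>
    u \<in> pverts G \<and> v \<in> pverts G \<and> u \<noteq> v \<and> (u, v) \<notin> parcs G"
  "(Inl u, Inr v) \<in> parcs (complementary_prism G) \<longleftrightarrow> u = v \<and> u \<in> pverts G"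
  "(Inr u, Inl v) \<in> parcs (complementary_prism G) \<longleftrightarrow> u = v \<and> u \<in> pverts G"
  "pverts (complementary_prism G) = pverts G <+> pverts G"
  by (auto simp: complementary_prism_def graph_complement_def)

text \<open>The only possible general position set with n + 1 elements containing both copies of v.\<close>

definition prism_candidate :: "'a pair_pre_digraph \<Rightarrow> 'a \<Rightarrow> ('a + 'a) set" where
  "prism_candidate G v = (pverts G - neighbourhood G v) <+> insert v (neighbourhood G v)"

context pair_graph
begin

lemma eccentricity_le_2_iff:
  assumes "v \<in> pverts G"
  shows "eccentricity G v \<le> 2 \<longleftrightarrow> (\<forall>w\<in>pverts G. w = v \<or> (v, w) \<in> parcs G \<or>
    (\<exists>u. (v, u) \<in> parcs G \<and> (u, w) \<in> parcs G))"
proof -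
  have "eccentricity G v \<le> 2 \<longleftrightarrow> (\<forall>w\<in>pverts G. graph_dist G v w \<le> 2)"
    unfolding eccentricity_def Setcompr_eq_image
    using assms by (subst Max_le_iff) auto
  then show ?thesis
    unfolding graph_dist_le_2_iff[OF assms] by (simp only: eq_commute)
qed

lemma eccentricity_ge_2:
  assumes "w \<in> pverts G" "w \<noteq> v" "(v, w) \<notin> parcs G"
  shows "2 \<le> eccentricity G v"
proof -
  have "graph_dist G v w \<le> eccentricity G v"
    unfolding eccentricity_def Setcompr_eq_image using assms(1) by (intro Max_ge) auto
  with graph_dist_ge_2[of v w] assms show ?thesis
    by (auto intro: order_trans)
qed

text \<open>If no vertex is adjacent to all others, every eccentricity is at least two, so
  \<open>v\<close> attains the minimum.\<close>

lemma radius_eq_2I: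
  assumes v: "v \<in> pverts G" "eccentricity G v \<le> 2"
    and nondom: "\<And>u. u \<in> pverts G \<Longrightarrow> \<exists>w\<in>pverts G. w \<noteq> u \<and> (u, w) \<notin> parcs G"
  shows "radius G = 2" "central G v"
proof -
  have ge: "2 \<le> eccentricity G u" if "u \<in> pverts G" for u
    using nondom[OF that] eccentricity_ge_2 by blast
  have ecc: "eccentricity G v = 2"
    using ge[OF v(1)] v(2) by (rule antisym[rotated])
  show rad: "radius G = 2"
    unfolding radius_def Setcompr_eq_image
  proof (rule Min_eqI)
    show "2 \<in> eccentricity G ` pverts G"
      using ecc v(1) by (metis imageI)
  qed (use ge in auto)
  show "central G v"
    using v(1) ecc rad by (simp add: central_def)
qed

text \<open>Nonadjacent copies in one layer are joined by crossing to the other layer, where they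
  are adjacent, and crossing back. Copies of different vertices in different layers need one
  crossing and one step in whichever layer has the edge.\<close>

lemma complementary_prism_apath_le_3:
  assumes "x \<in> pverts (complementary_prism G)" "y \<in> pverts (complementary_prism G)"
  shows "\<exists>q. pre_digraph.apath (with_proj (complementary_prism G)) x q y \<and> length q \<le> 3"
proof -
  interpret P: pair_graph "complementary_prism G"
    by (rule pair_graph_complementary_prism) (rule pair_graph)
  show ?thesis
  proof (cases "x = y \<or> (x, y) \<in> parcs (complementary_prism G)")
    case True
    then show ?thesis
    proof
      assume "x = y"
      then show ?thesis using assms by (intro exI[of _ "[]"]) (simp add: P.apath_Nil_iff)
    next
      assume xy: "(x, y) \<in> parcs (complementary_prism G)"
      then show ?thesis
        using P.apath_arcI[OF xy P.no_loops'[OF xy]] by (intro exI[of _ "[(x, y)]"]) simp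
    qed
  next
    case False
    have two: ?thesis if "(x, w) \<in> parcs (complementary_prism G)" "(w, y) \<in> parcs (complementary_prism G)" for w
      using P.apath_arcs2I[OF that] False P.no_loops'[OF that(1)] P.no_loops'[OF that(2)]
      by (intro exI[of _ "[(x, w), (w, y)]"]) simp
    show ?thesis
    proof (cases x; cases y)
      fix u v assume x: "x = Inl u" and y: "y = Inl v"
      then have "P.apath (Inl u) [(Inl u, Inr u), (Inr u, Inr v), (Inr v, Inl v)] (Inl v)"
        using False assms by (intro P.apath_arcs3I) (auto simp: complementary_prism_simps)
      then show ?thesis
        unfolding x y by (intro exI[of _ "[(Inl u, Inr u), (Inr u, Inr v), (Inr v, Inl v)]"]) simp
    next
      fix u v assume x: "x = Inl u" and y: "y = Inr v"
      show ?thesis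
        using two[of "if (u, v) \<in> parcs G then Inl v else Inr u"] False assms unfolding x y
        by (auto simp: complementary_prism_simps split: if_splits)
    next
      fix u v assume x: "x = Inr u" and y: "y = Inl v"
      show ?thesis
        using two[of "if (u, v) \<in> parcs G then Inl u else Inr v"] False assms unfolding x y
        by (auto simp: complementary_prism_simps split: if_splits)
    next
      fix u v assume x: "x = Inr u" and y: "y = Inr v"
      then have "P.apath (Inr u) [(Inr u, Inl u), (Inl u, Inl v), (Inl v, Inr v)] (Inr v)"
        using False assms by (intro P.apath_arcs3I) (auto simp: complementary_prism_simps)
      then show ?thesis
        unfolding x y by (intro exI[of _ "[(Inr u, Inl u), (Inl u, Inl v), (Inl v, Inr v)]"]) simp
    qed
  qed
qed

lemma general_position_set_prism_iff:
  "general_position_set (complementary_prism G) S \<longleftrightarrow> S \<subseteq> pverts G <+> pverts G \<and>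
    (\<forall>x\<in>S. \<forall>y\<in>S. \<forall>z\<in>S. x \<noteq> y \<and> z \<noteq> x \<and> z \<noteq> y \<longrightarrow>
      \<not> short_between (complementary_prism G) x z y)"
proof -
  interpret P: pair_graph "complementary_prism G"
    by (rule pair_graph_complementary_prism) (rule pair_graph)
  show ?thesis
    using P.general_position_set_iff_short_between[OF complementary_prism_apath_le_3]
    unfolding complementary_prism_simps(5) .
qed

text \<open>
  The paths u, u', v' (for v not adjacent to u) and u', u, v (for v adjacent to u) are geodesics,
  where primes denote copies in the complement.
\<close>

lemma general_position_prism_both_copies:
  assumes gp: "general_position_set (complementary_prism G) S"
    and u: "Inl u \<in> S" "Inr u \<in> S" and "v \<noteq> u"
  shows "Inr v \<in> S \<Longrightarrow> (u, v) \<in> parcs G" "Inl v \<in> S \<Longrightarrow> (u, v) \<notin> parcs G"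
proof -
  have uV: "u \<in> pverts G"
    using gp u by (auto simp: general_position_set_prism_iff)
  {
    assume v: "Inr v \<in> S"
    then have "\<not> short_between (complementary_prism G) (Inl u) (Inr u) (Inr v)"
      using gp u \<open>v \<noteq> u\<close> by (auto simp: general_position_set_prism_iff)
    moreover have "v \<in> pverts G"
      using gp v by (auto simp: general_position_set_prism_iff)
    ultimately show "(u, v) \<in> parcs G"
      using \<open>v \<noteq> u\<close> uV by (auto simp: short_between_def complementary_prism_simps)
  next
    assume v: "Inl v \<in> S"
    then have "\<not> short_between (complementary_prism G) (Inr u) (Inl u) (Inl v)"
      using gp u \<open>v \<noteq> u\<close> by (auto simp: general_position_set_prism_iff)
    then show "(u, v) \<notin> parcs G"
      using \<open>v \<noteq> u\<close> uV by (auto simp: short_between_def complementary_prism_simps)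
  }
qed

lemma neighbourhood_subset: "neighbourhood G v \<subseteq> pverts G"
  by (auto simp: neighbourhood_def dest: in_arcsD2)

text \<open>Every vertex contributes exactly one copy, except \<open>v\<close>, which contributes
  both.\<close>

lemma card_prism_candidate:
  assumes "v \<in> pverts G"
  shows "card (prism_candidate G v) = card (pverts G) + 1"
proof -
  have fin: "finite (neighbourhood G v)"
    using neighbourhood_subset by (rule finite_subset) simp
  have "v \<notin> neighbourhood G v"
    using no_loops' by (auto simp: neighbourhood_def)
  then have "card (prism_candidate G v) =
      card (pverts G) - card (neighbourhood G v) + (card (neighbourhood G v) + 1)"
    using fin by (simp add: prism_candidate_def card_Plus card_Diff_subset neighbourhood_subset)
  moreover have "card (neighbourhood G v) \<le> card (pverts G)"
    using neighbourhood_subset by (intro card_mono) auto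
  ultimately show ?thesis by simp
qed

lemma general_position_prism_card:
  assumes gp: "general_position_set (complementary_prism G) S"
  shows "card S \<le> card (pverts G) + 1"
    and "card S = card (pverts G) + 1 \<Longrightarrow> \<exists>v\<in>pverts G. S = prism_candidate G v"
proof -
  define A where "A = {u. Inl u \<in> S}"
  define B where "B = {u. Inr u \<in> S}"
  have S: "S = A <+> B"
  proof (intro set_eqI)
    fix x show "x \<in> S \<longleftrightarrow> x \<in> A <+> B"
      by (cases x) (auto simp: A_def B_def)
  qed
  have sub: "A \<subseteq> pverts G" "B \<subseteq> pverts G"
    using gp by (auto simp: general_position_set_prism_iff A_def B_def)
  then have fin: "finite A" "finite B"
    using finite_subset[OF _ pair_finite_verts] by blast+
  have nbr: "(u, w) \<in> parcs G" if "u \<in> A" "u \<in> B" "w \<in> B" "w \<noteq> u" for u w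
    using general_position_prism_both_copies(1)[OF gp] that by (simp add: A_def B_def)
  have non_nbr: "(u, w) \<notin> parcs G" if "u \<in> A" "u \<in> B" "w \<in> A" "w \<noteq> u" for u w
    using general_position_prism_both_copies(2)[OF gp] that by (simp add: A_def B_def)
  \<comment> \<open>Two vertices with both copies in \<open>S\<close> would have to be adjacent and
    nonadjacent at once.\<close>
  have "\<forall>u\<in>A \<inter> B. \<forall>w\<in>A \<inter> B. u = w"
    using nbr non_nbr by blast
  then have int: "card (A \<inter> B) \<le> 1"
    using fin card_le_Suc0_iff_eq[of "A \<inter> B"] unfolding One_nat_def by blast
  have un: "card (A \<union> B) \<le> card (pverts G)"
    using sub by (intro card_mono) auto
  have card: "card S = card (A \<union> B) + card (A \<inter> B)"
    unfolding S card_Plus[OF fin] by (rule card_Un_Int[OF fin])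
  show "card S \<le> card (pverts G) + 1"
    using card int un by simp
  assume "card S = card (pverts G) + 1"
  then have eq: "card (A \<inter> B) = 1" "card (A \<union> B) = card (pverts G)"
    using card int un by auto
  then obtain v where v: "A \<inter> B = {v}"
    by (auto simp: card_1_singleton_iff)
  \<comment> \<open>Equality leaves no vertex out, so adjacency to \<open>v\<close> decides in which
    layer each other vertex is represented.\<close>
  have V: "A \<union> B = pverts G"
    using sub eq(2) by (intro card_subset_eq) auto
  have "v \<in> A" "v \<in> B"
    using v by auto
  have "B = insert v (neighbourhood G v)"
  proof (intro set_eqI iffI)
    fix w assume "w \<in> B"
    then show "w \<in> insert v (neighbourhood G v)"
      using nbr[OF \<open>v \<in> A\<close> \<open>v \<in> B\<close>] by (auto simp: neighbourhood_def)
  next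
    fix w assume "w \<in> insert v (neighbourhood G v)"
    then show "w \<in> B"
      using non_nbr[OF \<open>v \<in> A\<close> \<open>v \<in> B\<close>, of w] V \<open>v \<in> B\<close> no_loops'[of v w] in_arcsD2[of v w]
      by (auto simp: neighbourhood_def)
  qed
  moreover have "A = pverts G - neighbourhood G v"
  proof (intro set_eqI iffI)
    fix w assume "w \<in> A"
    then show "w \<in> pverts G - neighbourhood G v"
      using non_nbr[OF \<open>v \<in> A\<close> \<open>v \<in> B\<close>, of w] V no_loops'[of v w] by (auto simp: neighbourhood_def)
  next
    fix w assume "w \<in> pverts G - neighbourhood G v"
    then show "w \<in> A"
      using nbr[OF \<open>v \<in> A\<close> \<open>v \<in> B\<close>, of w] V \<open>v \<in> A\<close> by (auto simp: neighbourhood_def)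
  qed
  moreover have "v \<in> pverts G"
    using v sub by auto
  ultimately show "\<exists>v\<in>pverts G. S = prism_candidate G v"
    unfolding S prism_candidate_def by blast
qed

lemma gp_number_prism_eq_iff:
  "gp_number (complementary_prism G) = card (pverts G) + 1 \<longleftrightarrow>
    (\<exists>v\<in>pverts G. general_position_set (complementary_prism G) (prism_candidate G v))"
proof -
  let ?C = "{card S |S. general_position_set (complementary_prism G) S}"
  have "?C \<subseteq> {..card (pverts G) + 1}"
    using general_position_prism_card(1) by auto
  then have fin: "finite ?C"
    by (rule finite_subset) simp
  \<comment> \<open>The empty set ensures that \<open>Max\<close> is taken over a nonempty
    set.\<close>
  have "general_position_set (complementary_prism G) {}"
    by (simp add: general_position_set_def)
  then have ne: "?C \<noteq> {}"
    by blast
  have "gp_number (complementary_prism G) = card (pverts G) + 1 \<longleftrightarrow> card (pverts G) + 1 \<in> ?C"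
  proof
    assume "gp_number (complementary_prism G) = card (pverts G) + 1"
    then show "card (pverts G) + 1 \<in> ?C"
      using Max_in[OF fin ne] unfolding gp_number_def by (rule subst)
  next
    assume "card (pverts G) + 1 \<in> ?C"
    then show "gp_number (complementary_prism G) = card (pverts G) + 1"
      unfolding gp_number_def using \<open>?C \<subseteq> _\<close> by (intro Max_eqI fin) auto
  qed
  also have "\<dots> \<longleftrightarrow> (\<exists>v\<in>pverts G. general_position_set (complementary_prism G) (prism_candidate G v))"
    (is "_ \<longleftrightarrow> ?R")
  proof
    assume "card (pverts G) + 1 \<in> ?C"
    then obtain S where S: "general_position_set (complementary_prism G) S" "card S = card (pverts G) + 1"
      by force
    show ?R
      using general_position_prism_card(2)[OF S] S(1) by auto
  next
    assume ?R
    then obtain v where "v \<in> pverts G" "general_position_set (complementary_prism G) (prism_candidate G v)"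
      by blast
    then show "card (pverts G) + 1 \<in> ?C"
      using card_prism_candidate[of v] by (auto intro: exI[of _ "prism_candidate G v"])
  qed
  finally show ?thesis .
qed

text \<open>Consecutive vertices differ because there are no loops, so distinctness has to be
  assumed only for opposite ones.\<close>

lemma block_graph_C4:
  assumes "block_graph G" "(a, b) \<in> parcs G" "(b, c) \<in> parcs G" "(c, d) \<in> parcs G" "(d, a) \<in> parcs G"
    and "a \<noteq> c" "b \<noteq> d"
  shows "(a, c) \<in> parcs G"
proof -
  have "distinct [a, b, c, d]"
    using assms no_loops' by auto
  then show ?thesis
    using block_graph_cycle_clique[of "[a, b, c, d]" a c] assms by simp
qed

lemma block_graph_C5:
  assumes "block_graph G" "(a, b) \<in> parcs G" "(b, c) \<in> parcs G" "(c, d) \<in> parcs G"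
    "(d, e) \<in> parcs G" "(e, a) \<in> parcs G" and "distinct [a, b, c, d, e]"
  shows "(a, c) \<in> parcs G"
  using block_graph_cycle_clique[of "[a, b, c, d, e]" a c] assms by simp

end

section \<open>Block graphs rooted at a vertex of eccentricity at most two\<close>

text \<open>\<open>within_2\<close> is the adjacency form of \<open>v\<close> having eccentricity at
  most two; it also makes \<open>G\<close> connected. Below, an outer vertex is one at distance two
  from \<open>v\<close>, and its parents are its neighbours inside
  \<open>neighbourhood G v\<close>.\<close>

locale rooted_block_graph = pair_graph +
  fixes v
  assumes block: "block_graph G"
    and root: "v \<in> pverts G"
    and within_2: "\<And>w. w \<in> pverts G \<Longrightarrow>
      w = v \<or> (v, w) \<in> parcs G \<or> (\<exists>u. (v, u) \<in> parcs G \<and> (u, w) \<in> parcs G)"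
begin

text \<open>Two parents \<open>x\<close>, \<open>y\<close> of \<open>m\<close> would close the
  4-cycle \<open>v\<close>, \<open>x\<close>, \<open>m\<close>, \<open>y\<close>, whose diagonal
  would make \<open>m\<close> adjacent to \<open>v\<close>.\<close>

lemma outer_parent_unique:
  assumes "m \<noteq> v" "(v, m) \<notin> parcs G" "(v, x) \<in> parcs G" "(x, m) \<in> parcs G"
    "(v, y) \<in> parcs G" "(y, m) \<in> parcs G"
  shows "x = y"
proof (rule ccontr)
  assume "x \<noteq> y"
  with assms have "(v, m) \<in> parcs G"
    by (intro block_graph_C4[OF block, of v x m y]) (auto intro: arcs_symmetric)
  with assms(2) show False by blast
qed

text \<open>Different parents of adjacent outer vertices would close a 5-cycle through
  \<open>v\<close>, again making \<open>m\<close> adjacent to \<open>v\<close>.\<close>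

lemma adjacent_outer_parent:
  assumes m: "m \<noteq> v" "(v, m) \<notin> parcs G" and m': "m' \<noteq> v" "(v, m') \<notin> parcs G"
    and mm': "(m, m') \<in> parcs G" and x: "(v, x) \<in> parcs G" "(x, m) \<in> parcs G"
  shows "(x, m') \<in> parcs G"
proof -
  have "m' \<in> pverts G" using mm' by (rule in_arcsD2)
  then obtain y where y: "(v, y) \<in> parcs G" "(y, m') \<in> parcs G"
    using within_2 m' by blast
  have "x = y"
  proof (rule ccontr)
    assume "x \<noteq> y"
    then have "distinct [v, x, m, m', y]"
      using m m' mm' x y no_loops' by auto
    then have "(v, m) \<in> parcs G"
      using block_graph_C5[OF block, of v x m m' y] mm' x y by (auto intro: arcs_symmetric)
    with m(2) show False by blast
  qed
  with y show ?thesis by simp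
qed

text \<open>If \<open>x\<close> is not a parent, \<open>v\<close> still reaches everything after
  \<open>x\<close> is deleted. If \<open>x\<close> is the parent of \<open>m\<close>, then without
  \<open>x\<close> only outer vertices with parent \<open>x\<close> can be reached from
  \<open>m\<close>, which excludes \<open>v\<close>.\<close>

lemma cut_vertex_neighbour_iff:
  assumes x: "(v, x) \<in> parcs G"
  shows "cut_vertex G x \<longleftrightarrow> (\<exists>m. m \<noteq> v \<and> (v, m) \<notin> parcs G \<and> (x, m) \<in> parcs G)"
proof -
  let ?H = "with_proj G \<restriction> (pverts G - {x})"
  interpret H: graph ?H
    by (rule graph_induce_subgraph) auto
  have xv: "x \<in> pverts G" "x \<noteq> v"
    using x no_loops' by (auto dest: in_arcsD2)
  have "v \<rightarrow>\<^sup>*\<^bsub>with_proj G\<^esub> w" if "w \<in> pverts G" for w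
    using within_2[OF that] root
    by (auto intro: reachable_adjI adj_reachable_trans)
  then have G1: "num_components (with_proj G) = 1"
    using root by (intro num_components_eq_1I[of v]) simp_all
  have cut: "cut_vertex G x \<longleftrightarrow> num_components ?H > 1"
    unfolding cut_vertex_def G1 del_vert_eq_induce_subgraph using xv by simp
  show ?thesis
  proof
    assume "cut_vertex G x"
    show "\<exists>m. m \<noteq> v \<and> (v, m) \<notin> parcs G \<and> (x, m) \<in> parcs G"
    proof (rule ccontr)
      assume none: "\<nexists>m. m \<noteq> v \<and> (v, m) \<notin> parcs G \<and> (x, m) \<in> parcs G"
      have "v \<rightarrow>\<^sup>*\<^bsub>?H\<^esub> w" if w: "w \<in> verts ?H" for w
      proof -
        have H_arc: "a \<rightarrow>\<^bsub>?H\<^esub> b" if "(a, b) \<in> parcs G" "a \<noteq> x" "b \<noteq> x" for a b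
          using that by (simp add: arc_in_induce_subgraph in_arcsD1 in_arcsD2)
        have "w \<in> pverts G" "w \<noteq> x" using w by auto
        from within_2[OF this(1)] consider "w = v" | "(v, w) \<in> parcs G"
          | u where "w \<noteq> v" "(v, w) \<notin> parcs G" "(v, u) \<in> parcs G" "(u, w) \<in> parcs G"
          by blast
        then show ?thesis
        proof cases
          case 1
          then show ?thesis using w by simp
        next
          case 2
          then have "v \<rightarrow>\<^bsub>?H\<^esub> w" using H_arc \<open>w \<noteq> x\<close> xv by simp
          then show ?thesis by (rule H.reachable_adjI)
        next
          case 3
          \<comment> \<open>Since \<open>x\<close> has no outer neighbour, the parent of
            \<open>w\<close> survives the deletion.\<close>
          then have "u \<noteq> x" using none by blast
          then have "v \<rightarrow>\<^bsub>?H\<^esub> u" "u \<rightarrow>\<^bsub>?H\<^esub> w" using 3 H_arc \<open>w \<noteq> x\<close> xv by simp_all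
          then show ?thesis by (meson H.reachable_adjI H.adj_reachable_trans)
        qed
      qed
      then have "num_components ?H = 1"
        using root xv by (intro H.num_components_eq_1I[of v]) auto
      with \<open>cut_vertex G x\<close> show False by (simp add: cut)
    qed
  next
    assume "\<exists>m. m \<noteq> v \<and> (v, m) \<notin> parcs G \<and> (x, m) \<in> parcs G"
    then obtain m where m: "m \<noteq> v" "(v, m) \<notin> parcs G" "(x, m) \<in> parcs G"
      by blast
    \<comment> \<open>Invariant along walks avoiding \<open>x\<close>: a step to \<open>v\<close> or
      to another neighbour of \<open>v\<close> would contradict that \<open>y\<close> is outer with
      unique parent \<open>x\<close>.\<close>
    have "w \<noteq> v \<and> (v, w) \<notin> parcs G \<and> (x, w) \<in> parcs G" if "m \<rightarrow>\<^sup>*\<^bsub>?H\<^esub> w" for w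
      using that
    proof (induction rule: H.reachable_induct)
      case base
      then show ?case using m by blast
    next
      case (step y z)
      then have yz: "(y, z) \<in> parcs G" "z \<noteq> x"
        by (auto simp: arc_in_induce_subgraph)
      have "z \<noteq> v"
        using step yz arcs_symmetric by blast
      moreover have "(v, z) \<notin> parcs G"
        using step yz outer_parent_unique[of y x z] x arcs_symmetric by blast
      ultimately show ?case
        using step yz x adjacent_outer_parent[of y z x] by blast
    qed
    then have "\<not> m \<rightarrow>\<^sup>*\<^bsub>?H\<^esub> v"
      by blast
    moreover have "m \<in> pverts G" "m \<noteq> x"
      using m(3) no_loops' by (auto dest: in_arcsD2)
    ultimately have "num_components ?H > 1"
      using root xv by (intro H.num_components_gt_1I[of m v]) auto
    then show "cut_vertex G x" by (simp add: cut)
  qed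
qed

text \<open>Let \<open>x\<close>, \<open>y\<close> be an edge in the neighbourhood. Any further
  \<open>z\<close> is adjacent to \<open>x\<close> or, by \<open>sep\<close>, to \<open>y\<close>,
  and then the 4-cycle \<open>x\<close>, \<open>y\<close>, \<open>z\<close>, \<open>v\<close> still
  gives the edge from \<open>x\<close> to \<open>z\<close>. So \<open>x\<close> is adjacent to the
  rest, and 4-cycles \<open>a\<close>, \<open>v\<close>, \<open>b\<close>, \<open>x\<close> make all
  pairs adjacent.\<close>

lemma neighbourhood_clique_or_independent:
  assumes sep: "\<And>x y z. (v, x) \<in> parcs G \<Longrightarrow> (v, y) \<in> parcs G \<Longrightarrow> (v, z) \<in> parcs G \<Longrightarrow>
    (x, y) \<in> parcs G \<Longrightarrow> z \<noteq> x \<Longrightarrow> z \<noteq> y \<Longrightarrow> (x, z) \<in> parcs G \<or> (y, z) \<in> parcs G"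
  shows "clique G (neighbourhood G v) \<or> independent_set G (neighbourhood G v)"
proof (cases "independent_set G (neighbourhood G v)")
  case False
  then obtain x y where xy: "(v, x) \<in> parcs G" "(v, y) \<in> parcs G" "(x, y) \<in> parcs G"
    using neighbourhood_subset by (auto simp: independent_set_def neighbourhood_def)
  have x_dom: "z = x \<or> (x, z) \<in> parcs G" if z: "(v, z) \<in> parcs G" for z
  proof (rule ccontr)
    assume *: "\<not> ?thesis"
    then have "z \<noteq> y" using xy by blast
    then have "(y, z) \<in> parcs G"
      using sep[OF xy(1,2) z xy(3)] * by blast
    then have "(x, z) \<in> parcs G"
      using * z xy no_loops'[OF xy(2)]
      by (intro block_graph_C4[OF block, of x y z v]) (auto intro: arcs_symmetric)
    with * show False by blast
  qed
  have "(a, b) \<in> parcs G" if ab: "(v, a) \<in> parcs G" "(v, b) \<in> parcs G" "a \<noteq> b" for a b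
  proof (cases "a = x \<or> b = x")
    case True
    then show ?thesis using x_dom[OF ab(1)] x_dom[OF ab(2)] ab(3) arcs_symmetric by blast
  next
    case False
    then have "(x, a) \<in> parcs G" "(x, b) \<in> parcs G"
      using x_dom ab by blast+
    then show ?thesis
      using ab no_loops'[OF xy(1)]
      by (intro block_graph_C4[OF block, of a v b x]) (auto intro: arcs_symmetric)
  qed
  then show ?thesis
    using neighbourhood_subset by (auto simp: clique_def neighbourhood_def)
qed simp

text \<open>A forbidden \<open>z\<close> would lie in the middle of a two-arc path, excluded by
  \<open>direct\<close>, or on a three-arc geodesic. For the latter, \<open>indirect\<close>
  supplies a two-arc path between the same ends.\<close>

lemma general_position_prism_candidateI:
  assumes N: "clique G (neighbourhood G v) \<or> independent_set G (neighbourhood G v)"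
    and non_dom: "\<And>y. (v, y) \<in> parcs G \<Longrightarrow>
      \<exists>m\<in>pverts G. m \<noteq> v \<and> (v, m) \<notin> parcs G \<and> m \<noteq> y \<and> (y, m) \<notin> parcs G"
  shows "general_position_set (complementary_prism G) (prism_candidate G v)"
proof -
  let ?P = "complementary_prism G"
  interpret P: pair_graph ?P
    by (rule pair_graph_complementary_prism) (rule pair_graph)
  define A where "A = pverts G - neighbourhood G v"
  define B where "B = insert v (neighbourhood G v)"
  have S: "prism_candidate G v = A <+> B"
    by (simp add: prism_candidate_def A_def B_def)
  have A: "a \<in> pverts G" "(v, a) \<notin> parcs G" if "a \<in> A" for a
    using that by (auto simp: A_def neighbourhood_def)
  have B: "b = v \<or> (v, b) \<in> parcs G" "b \<in> pverts G" if "b \<in> B" for b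
    using that root by (auto simp: B_def neighbourhood_def dest: in_arcsD2)
  \<comment> \<open>The two layers of the candidate share only \<open>v\<close>, so a crossing edge
    with both ends in the candidate occurs only at \<open>v\<close>.\<close>
  have AB: "a = v" if "a \<in> A" "a \<in> B" for a
    using A[OF that(1)] B[OF that(2)] by blast
  have far: "\<exists>w. (a, w) \<in> parcs G \<and> (w, v) \<in> parcs G" if "a \<in> A" "a \<noteq> v" for a
    using within_2[OF A(1)[OF that(1)]] A(2)[OF that(1)] that(2) arcs_symmetric by blast
  have outer: "a \<noteq> v \<and> b \<noteq> v" if "a \<in> A" "b \<in> A" "(a, b) \<in> parcs G" for a b
    using A that arcs_symmetric by blast
  have parent: "\<exists>p. (v, p) \<in> parcs G \<and> (p, a) \<in> parcs G" if "a \<in> A" "a \<noteq> v" for a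
    using within_2[OF A(1)[OF that(1)]] A(2)[OF that(1)] that(2) by blast
  have near: "\<exists>m\<in>pverts G. m \<noteq> v \<and> m \<noteq> y \<and> (v, m) \<notin> parcs G \<and> (m, y) \<notin> parcs G" if "y \<in> B" "y \<noteq> v" for y
    using non_dom[of y] B(1)[OF that(1)] that(2) arcs_symmetric by blast

  \<comment> \<open>The parent of \<open>a\<close> is passed on along \<open>a\<close>,
    \<open>c\<close>, \<open>b\<close>, and a 4-cycle then makes \<open>a\<close> and
    \<open>b\<close> adjacent: the outer vertices induce a disjoint union of cliques.\<close>
  have inl: "\<not> ((a, c) \<in> parcs G \<and> (c, b) \<in> parcs G)"
    if abc: "a \<in> A" "b \<in> A" "c \<in> A" "a \<noteq> b" "(a, b) \<notin> parcs G" for a b c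
  proof
    assume *: "(a, c) \<in> parcs G \<and> (c, b) \<in> parcs G"
    then have ne: "a \<noteq> v" "b \<noteq> v" "c \<noteq> v"
      using outer abc by blast+
    then obtain p where p: "(v, p) \<in> parcs G" "(p, a) \<in> parcs G"
      using parent abc by blast
    have pc: "(p, c) \<in> parcs G"
      using adjacent_outer_parent[of a c p] ne A abc * p by blast
    have pb: "(p, b) \<in> parcs G"
      using adjacent_outer_parent[of c b p] ne A abc * p pc by blast
    have "(a, b) \<in> parcs G"
      using * p pb no_loops'[OF pc] abc(4)
      by (intro block_graph_C4[OF block, of a c b p]) (auto intro: arcs_symmetric)
    with abc(5) show False by blast
  qed
  \<comment> \<open>The vertex \<open>w\<close> may lie outside the candidate. If it is a neighbour
    of \<open>v\<close>, it is the parent of \<open>c\<close> and hence of \<open>a\<close>;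
    otherwise it is outer and passes the parent of \<open>a\<close> on to \<open>b\<close>.\<close>
  have inl3: "\<exists>w. (a, w) \<in> parcs G \<and> (w, b) \<in> parcs G"
    if abc: "a \<in> A" "b \<in> A" "c \<in> A" "(a, c) \<in> parcs G" "(c, w) \<in> parcs G" "(w, b) \<in> parcs G" for a b c w
  proof -
    have ne: "a \<noteq> v" "c \<noteq> v"
      using outer abc by blast+
    then obtain p where p: "(v, p) \<in> parcs G" "(p, a) \<in> parcs G"
      using parent abc by blast
    have pc: "(p, c) \<in> parcs G"
      using adjacent_outer_parent[of a c p] ne A abc p by blast
    have "w \<noteq> v"
      using abc A arcs_symmetric by blast
    show ?thesis
    proof (cases "(v, w) \<in> parcs G")
      case True
      then have "p = w"
        using outer_parent_unique[of c p w] ne A abc p pc arcs_symmetric by blast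
      then show ?thesis using p abc arcs_symmetric by blast
    next
      case False
      then have pw: "(p, w) \<in> parcs G"
        using adjacent_outer_parent[of c w p] ne A abc p pc \<open>w \<noteq> v\<close> by blast
      have "b \<noteq> v"
        using abc False arcs_symmetric by blast
      then have "(p, b) \<in> parcs G"
        using adjacent_outer_parent[of w b p] A abc p pw \<open>w \<noteq> v\<close> False by blast
      then show ?thesis using p arcs_symmetric by blast
    qed
  qed
  \<comment> \<open>A vertex nonadjacent to both in \<open>G\<close> is a common neighbour in the
    complement; \<open>non_dom\<close> yields one when \<open>v\<close> is an end.\<close>
  have common_inr: "x = y \<or> (x, y) \<notin> parcs G \<or>
      (\<exists>m\<in>pverts G. m \<noteq> x \<and> m \<noteq> y \<and> (x, m) \<notin> parcs G \<and> (m, y) \<notin> parcs G)"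
    if "x \<in> B" "y \<in> B" "x = v \<or> y = v" for x y
    using near[OF that(1)] near[OF that(2)] that(3) arcs_symmetric by blast
  \<comment> \<open>Nonadjacent ends in the complement layer form an edge of \<open>G\<close>. If
    they lie in the neighbourhood, it is a clique, so no complement edge leads to a third element
    there.\<close>
  have inr: "(x, z) \<in> parcs G \<or> y = v"
    if "x \<in> B" "y \<in> B" "z \<in> B" "distinct [x, z, y]" "(x, y) \<in> parcs G" for x y z
  proof (cases "x = v \<or> y = v \<or> z = v")
    case True
    then show ?thesis using B that arcs_symmetric by fastforce
  next
    case False
    then have "x \<in> neighbourhood G v" "y \<in> neighbourhood G v" "z \<in> neighbourhood G v"
      using that by (auto simp: B_def)
    then show ?thesis
      using N that by (auto simp: clique_def independent_set_def)
  qed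

  \<comment> \<open>Each pair of distinct vertices is an edge of \<open>G\<close> or of the
    complement, so ends in different layers are at distance at most two.\<close>
  have mixed: "\<exists>w. (Inl a, w) \<in> parcs ?P \<and> (w, Inr b) \<in> parcs ?P" if "a \<noteq> b" "a \<in> A" "b \<in> B" for a b
  proof (cases "(a, b) \<in> parcs G")
    case True
    then show ?thesis using that B by (intro exI[of _ "Inl b"]) (simp add: complementary_prism_simps)
  next
    case False
    then show ?thesis using that A B by (intro exI[of _ "Inr a"]) (simp add: complementary_prism_simps)
  qed

  have Plus_simps [simp]: "Inl a \<in> A <+> B \<longleftrightarrow> a \<in> A" "Inr b \<in> A <+> B \<longleftrightarrow> b \<in> B" for a b
    by auto
  have direct: "\<not> ((x, z) \<in> parcs ?P \<and> (z, y) \<in> parcs ?P)"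
    if xyz: "x \<in> A <+> B" "y \<in> A <+> B" "z \<in> A <+> B" "distinct [x, z, y]" "(x, y) \<notin> parcs ?P" for x y z
  proof (cases x; cases y; cases z)
    fix a b c assume [simp]: "x = Inl a" "y = Inl b" "z = Inl c"
    show ?thesis using inl[of a b c] xyz by (simp add: complementary_prism_simps)
  next
    fix a b c assume [simp]: "x = Inr a" "y = Inr b" "z = Inr c"
    show ?thesis using inr[of a b c] B[of b] B[of c] xyz arcs_symmetric by (auto simp: complementary_prism_simps)
  next
    fix a b c assume [simp]: "x = Inl a" "y = Inr b" "z = Inl c"
    show ?thesis using AB[of c] A[of a] xyz arcs_symmetric by (auto simp: complementary_prism_simps)
  next
    fix a b c assume [simp]: "x = Inr a" "y = Inl b" "z = Inl c"
    show ?thesis using AB[of c] A[of b] xyz by (auto simp: complementary_prism_simps)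
  next
    fix a b c assume [simp]: "x = Inl a" "y = Inr b" "z = Inr c"
    show ?thesis using AB[of a] B[of b] xyz by (auto simp: complementary_prism_simps)
  next
    fix a b c assume [simp]: "x = Inr a" "y = Inl b" "z = Inr c"
    show ?thesis using AB[of b] B[of a] xyz arcs_symmetric by (auto simp: complementary_prism_simps)
  qed (use xyz in \<open>auto simp: complementary_prism_simps\<close>)

  have indirect: "\<exists>w. (x, w) \<in> parcs ?P \<and> (w, y) \<in> parcs ?P"
    if xyz: "x \<in> A <+> B" "y \<in> A <+> B" "z \<in> A <+> B" "distinct [x, z, y]" "(x, y) \<notin> parcs ?P"
      and xzwy: "(x, z) \<in> parcs ?P" "(z, w) \<in> parcs ?P" "(w, y) \<in> parcs ?P" for x y z w
  proof (cases x; cases y)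
    fix a b assume [simp]: "x = Inl a" "y = Inr b"
    show ?thesis using mixed[of a b] A[of a] xyz by (auto simp: complementary_prism_simps)
  next
    fix a b assume [simp]: "x = Inr a" "y = Inl b"
    have "b \<noteq> a"
      using A[of b] xyz by (auto simp: complementary_prism_simps)
    then obtain u where "(Inl b, u) \<in> parcs ?P" "(u, Inr a) \<in> parcs ?P"
      using mixed[of b a] xyz by auto
    then show ?thesis using P.arcs_symmetric by (intro exI[of _ u]) simp
  next
    fix a b assume [simp]: "x = Inl a" "y = Inl b"
    show ?thesis
    proof (cases z)
      case (Inl c)
      then obtain d where "w = Inl d"
        using xyz xzwy by (cases w) (auto simp: complementary_prism_simps)
      then show ?thesis
        using inl3[of a b c d] Inl xyz xzwy by (auto simp: complementary_prism_simps intro: exI[of _ "Inl _"])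
    next
      case (Inr c)
      \<comment> \<open>The path starts with a crossing edge inside the candidate, so
        \<open>far\<close> applies to the other end.\<close>
      then have "a = v"
        using AB[of a] xyz xzwy by (simp add: complementary_prism_simps)
      then obtain u where "(b, u) \<in> parcs G" "(u, a) \<in> parcs G"
        using far[of b] xyz by auto
      then show ?thesis
        using arcs_symmetric by (intro exI[of _ "Inl u"]) (auto simp: complementary_prism_simps)
    qed
  next
    fix a b assume [simp]: "x = Inr a" "y = Inr b"
    have ab: "a \<in> B" "b \<in> B" "a \<noteq> b" "(a, b) \<in> parcs G"
      using xyz B by (auto simp: complementary_prism_simps)
    \<comment> \<open>Either the first arc is a crossing edge, which puts \<open>a\<close> at
      \<open>v\<close>, or it is a complement edge, which \<open>inr\<close> allows only for
      \<open>b\<close> equal to \<open>v\<close>.\<close>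
    have "a = v \<or> b = v"
    proof (cases z)
      case (Inl c)
      then show ?thesis
        using AB[of a] xyz xzwy by (simp add: complementary_prism_simps)
    next
      case (Inr c)
      then show ?thesis
        using inr[of a b c] ab xyz xzwy by (simp add: complementary_prism_simps)
    qed
    then obtain m where "m \<in> pverts G" "m \<noteq> a" "m \<noteq> b" "(a, m) \<notin> parcs G" "(m, b) \<notin> parcs G"
      using common_inr[of a b] ab by blast
    then show ?thesis
      using ab B by (intro exI[of _ "Inr m"]) (simp add: complementary_prism_simps)
  qed

  have "\<not> short_between ?P x z y"
    if xyz: "x \<in> A <+> B" "y \<in> A <+> B" "z \<in> A <+> B" "x \<noteq> y" "z \<noteq> x" "z \<noteq> y" for x y z
  proof
    assume sb: "short_between ?P x z y"
    then have "(x, y) \<notin> parcs ?P" "(y, x) \<notin> parcs ?P"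
      using P.arcs_symmetric by (auto simp: short_between_def)
    \<comment> \<open>A three-arc path with \<open>z\<close> next to \<open>y\<close> is read
      backwards, hence the second use of \<open>indirect\<close> with the ends exchanged.\<close>
    then show False
      using sb direct[of x y z] indirect[of x y z] indirect[of y x z] xyz P.arcs_symmetric
      unfolding short_between_def by (metis distinct_length_2_or_more distinct_singleton)
  qed
  moreover have "A <+> B \<subseteq> pverts G <+> pverts G"
    using A B by auto
  ultimately show ?thesis
    unfolding general_position_set_prism_iff S by blast
qed

end

section \<open>Necessary conditions for the candidate set\<close>

context pair_graph
begin

text \<open>Violating a condition exposes a geodesic through three elements of the candidate. With
  primes for complement copies these are, in order, \<open>v\<close>, \<open>v'\<close>,
  \<open>w'\<close>, \<open>w\<close>; then \<open>x'\<close>, \<open>z'\<close>, \<open>y'\<close>;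
  then \<open>v'\<close>, \<open>v\<close>, \<open>x\<close>, \<open>x'\<close>.\<close>

lemma general_position_prism_candidateD:
  assumes v: "v \<in> pverts G"
    and gp: "general_position_set (complementary_prism G) (prism_candidate G v)"
  shows "w \<in> pverts G \<Longrightarrow>
      w = v \<or> (v, w) \<in> parcs G \<or> (\<exists>u. (v, u) \<in> parcs G \<and> (u, w) \<in> parcs G)" (is "_ \<Longrightarrow> ?near")
    and "(v, x) \<in> parcs G \<Longrightarrow> (v, y) \<in> parcs G \<Longrightarrow> (v, z) \<in> parcs G \<Longrightarrow>
      (x, y) \<in> parcs G \<Longrightarrow> z \<noteq> x \<Longrightarrow> z \<noteq> y \<Longrightarrow> (x, z) \<in> parcs G \<or> (y, z) \<in> parcs G"
    and "(v, x) \<in> parcs G \<Longrightarrow>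
      \<exists>m\<in>pverts G. m \<noteq> v \<and> (v, m) \<notin> parcs G \<and> m \<noteq> x \<and> (x, m) \<notin> parcs G" (is "_ \<Longrightarrow> ?far")
proof -
  let ?P = "complementary_prism G"
  have cand: "Inl a \<in> prism_candidate G v \<longleftrightarrow> a \<in> pverts G \<and> (v, a) \<notin> parcs G"
    "Inr a \<in> prism_candidate G v \<longleftrightarrow> a = v \<or> (v, a) \<in> parcs G" for a
    by (auto simp: prism_candidate_def neighbourhood_def)
  have vv: "(v, v) \<notin> parcs G"
    using no_loops' by blast
  have gpD: "\<not> short_between ?P a c b" if "a \<in> prism_candidate G v" "b \<in> prism_candidate G v"
    "c \<in> prism_candidate G v" "a \<noteq> b" "c \<noteq> a" "c \<noteq> b" for a b c
    using gp that unfolding general_position_set_prism_iff by blast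
  {
    assume w: "w \<in> pverts G"
    show ?near
    proof (rule ccontr)
      assume far: "\<not> ?near"
      have "short_between ?P (Inl v) (Inr v) (Inl w)"
        unfolding short_between_def split_sum_ex
        using far v w by (simp add: complementary_prism_simps) blast
      moreover have "\<not> short_between ?P (Inl v) (Inr v) (Inl w)"
        using far v w vv by (intro gpD) (auto simp: cand)
      ultimately show False by blast
    qed
  next
    assume xyz: "(v, x) \<in> parcs G" "(v, y) \<in> parcs G" "(v, z) \<in> parcs G" "(x, y) \<in> parcs G" "z \<noteq> x" "z \<noteq> y"
    show "(x, z) \<in> parcs G \<or> (y, z) \<in> parcs G"
    proof (rule ccontr)
      assume "\<not> ?thesis"
      then have "short_between ?P (Inr x) (Inr z) (Inr y)"
        using xyz arcs_symmetric by (auto simp: short_between_def complementary_prism_simps dest: in_arcsD2)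
      moreover have "\<not> short_between ?P (Inr x) (Inr z) (Inr y)"
        using xyz no_loops' by (intro gpD) (auto simp: cand)
      ultimately show False by blast
    qed
  next
    assume x: "(v, x) \<in> parcs G"
    then have xv: "x \<in> pverts G" "x \<noteq> v"
      using no_loops' by (auto dest: in_arcsD2)
    show ?far
    proof (rule ccontr)
      assume none: "\<not> ?far"
      then have none': "\<not> (a \<in> pverts G \<and> v \<noteq> a \<and> (v, a) \<notin> parcs G \<and> a \<noteq> x \<and> (a, x) \<notin> parcs G)" for a
        using arcs_symmetric[of x a] by auto
      have "short_between ?P (Inr v) (Inl v) (Inr x)"
        unfolding short_between_def split_sum_ex
        using none' x v xv by (simp add: complementary_prism_simps)
      moreover have "\<not> short_between ?P (Inr v) (Inl v) (Inr x)"
        using x v xv vv by (intro gpD) (auto simp: cand)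
      ultimately show False by blast
    qed
  }
qed

end

section \<open>Two cut vertices next to the root, and the equivalence\<close>

context rooted_block_graph
begin

text \<open>The cut vertices next to \<open>v\<close> are the parents of outer vertices. As parents
  are unique, an outer vertex nonadjacent to \<open>y\<close> is one whose parent is not
  \<open>y\<close>; having such a vertex for every \<open>y\<close> means having two
  parents.\<close>

lemma card_cut_vertices_ge_2_iff:
  "card {w \<in> neighbourhood G v. cut_vertex G w} \<ge> 2 \<longleftrightarrow>
    neighbourhood G v \<noteq> {} \<and> (\<forall>y. (v, y) \<in> parcs G \<longrightarrow>
      (\<exists>m\<in>pverts G. m \<noteq> v \<and> (v, m) \<notin> parcs G \<and> m \<noteq> y \<and> (y, m) \<notin> parcs G))" (is "?L \<longleftrightarrow> ?R")
proof
  let ?C = "{w \<in> neighbourhood G v. cut_vertex G w}"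
  have fin: "finite ?C"
    using finite_subset[OF neighbourhood_subset[of v] pair_finite_verts] by simp
  have mem: "w \<in> ?C \<longleftrightarrow> (v, w) \<in> parcs G \<and> (\<exists>m. m \<noteq> v \<and> (v, m) \<notin> parcs G \<and> (w, m) \<in> parcs G)" for w
    using cut_vertex_neighbour_iff[of w] by (auto simp: neighbourhood_def)
  {
    assume L: ?L
    have "\<exists>m\<in>pverts G. m \<noteq> v \<and> (v, m) \<notin> parcs G \<and> m \<noteq> y \<and> (y, m) \<notin> parcs G"
      if y: "(v, y) \<in> parcs G" for y
    proof -
      have "\<not> ?C \<subseteq> {y}"
        using card_mono[of "{y}" ?C] L by auto
      then obtain x m where x: "x \<noteq> y" "(v, x) \<in> parcs G"
        and m: "m \<noteq> v" "(v, m) \<notin> parcs G" "(x, m) \<in> parcs G"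
        unfolding mem subset_iff by blast
      have "(y, m) \<notin> parcs G"
        using outer_parent_unique[OF m(1,2) x(2) m(3) y] x(1) by blast
      moreover have "m \<noteq> y"
        using m(2) y by blast
      ultimately show ?thesis
        using m(1,2) in_arcsD2[OF m(3)] by (intro bexI[of _ m]) simp_all
    qed
    moreover have "?C \<noteq> {}"
    proof
      assume "?C = {}"
      with L show False by (simp only: card.empty)
    qed
    moreover from this have "neighbourhood G v \<noteq> {}"
      by blast
    ultimately show ?R
      by (intro conjI allI impI)
  next
    assume R: ?R
    have ex: "\<exists>x\<in>?C. x \<noteq> y" if y: "(v, y) \<in> parcs G" for y
    proof -
      from R y obtain m where m: "m \<in> pverts G" "m \<noteq> v" "(v, m) \<notin> parcs G" "(y, m) \<notin> parcs G"
        by blast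
      then obtain x where x: "(v, x) \<in> parcs G" "(x, m) \<in> parcs G"
        using within_2[OF m(1)] by blast
      then have "x \<in> ?C"
        unfolding mem using m by (intro conjI exI[of _ m])
      moreover have "x \<noteq> y"
        using x m(4) by blast
      ultimately show ?thesis by (rule bexI[rotated])
    qed
    \<comment> \<open>A nonempty neighbourhood starts the choice; the second use of
      \<open>ex\<close> avoids the cut vertex found first.\<close>
    obtain y where "(v, y) \<in> parcs G"
      using R by (auto simp: neighbourhood_def)
    from ex[OF this] obtain x where x: "x \<in> ?C"
      by (elim bexE)
    then have "(v, x) \<in> parcs G"
      unfolding mem by (rule conjunct1)
    from ex[OF this] obtain x' where x': "x' \<in> ?C" "x' \<noteq> x"
      by (elim bexE)
    have "card {x, x'} \<le> card ?C"
      using x x'(1) by (intro card_mono fin insert_subsetI) simp_all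
    then show ?L
      using x'(2) by simp
  }
qed

end

theorem theorem7p1:
  fixes G :: "'a pair_pre_digraph"
  assumes "pair_graph G"
    and "card (pverts G) \<noteq> 1"
    and "block_graph G"
  shows "gp_number (complementary_prism G) = card (pverts G) + 1 \<longleftrightarrow>
    radius G = 2 \<and>
    (\<exists>v. central G v \<and>
      (clique G (neighbourhood G v) \<or> independent_set G (neighbourhood G v)) \<and>
      card {w \<in> neighbourhood G v. cut_vertex G w} \<ge> 2)"
proof -
  interpret pair_graph G by fact
  show ?thesis
    unfolding gp_number_prism_eq_iff
  proof
    assume "\<exists>v\<in>pverts G. general_position_set (complementary_prism G) (prism_candidate G v)"
    then obtain v where v: "v \<in> pverts G"
      and gp: "general_position_set (complementary_prism G) (prism_candidate G v)"
      by blast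
    note cond = general_position_prism_candidateD[OF v gp]
    interpret rooted_block_graph G v
      using assms(3) v cond(1) by unfold_locales
    \<comment> \<open>A second vertex exists, and by \<open>within_2\<close> it forces
      \<open>v\<close> to have a neighbour.\<close>
    have "pverts G \<noteq> {v}"
      using assms(2) by auto
    then obtain w where "w \<in> pverts G" "w \<noteq> v"
      using v by blast
    then have ne: "neighbourhood G v \<noteq> {}"
      using within_2[of w] by (auto simp: neighbourhood_def)
    then obtain y where y: "(v, y) \<in> parcs G"
      by (auto simp: neighbourhood_def)
    then obtain m where m: "m \<in> pverts G" "m \<noteq> v" "(v, m) \<notin> parcs G"
      using cond(3) by blast
    have ecc: "eccentricity G v \<le> 2"
      using within_2 by (subst eccentricity_le_2_iff[OF v]) blast
    \<comment> \<open>The missed vertex is \<open>m\<close> for \<open>v\<close> itself, comes from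
      the third necessary condition for a neighbour of \<open>v\<close>, and is \<open>v\<close> for
      an outer vertex.\<close>
    have nondom: "\<exists>w\<in>pverts G. w \<noteq> u \<and> (u, w) \<notin> parcs G" if u: "u \<in> pverts G" for u
    proof -
      consider "u = v" | "(v, u) \<in> parcs G" | "u \<noteq> v" "(v, u) \<notin> parcs G"
        by blast
      then show ?thesis
      proof cases
        case 1 then show ?thesis using m by blast
      next
        case 2 then show ?thesis using cond(3) by blast
      next
        case 3 then show ?thesis using v arcs_symmetric[of u v] by (intro bexI[of _ v]) auto
      qed
    qed
    have "clique G (neighbourhood G v) \<or> independent_set G (neighbourhood G v)"
      using cond(2) by (rule neighbourhood_clique_or_independent)
    moreover have "card {w \<in> neighbourhood G v. cut_vertex G w} \<ge> 2"
      unfolding card_cut_vertices_ge_2_iff using ne cond(3) by blast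
    ultimately show "radius G = 2 \<and> (\<exists>v. central G v \<and>
      (clique G (neighbourhood G v) \<or> independent_set G (neighbourhood G v)) \<and>
      card {w \<in> neighbourhood G v. cut_vertex G w} \<ge> 2)"
      using radius_eq_2I[OF v ecc nondom] by blast
  next
    assume "radius G = 2 \<and> (\<exists>v. central G v \<and>
      (clique G (neighbourhood G v) \<or> independent_set G (neighbourhood G v)) \<and>
      card {w \<in> neighbourhood G v. cut_vertex G w} \<ge> 2)"
    \<comment> \<open>A central vertex has eccentricity equal to the radius, which is two.\<close>
    then obtain v where v: "v \<in> pverts G" and ecc: "eccentricity G v \<le> 2"
      and N: "clique G (neighbourhood G v) \<or> independent_set G (neighbourhood G v)"
      and cut: "card {w \<in> neighbourhood G v. cut_vertex G w} \<ge> 2"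
      by (auto simp: central_def)
    interpret rooted_block_graph G v
      using assms(3) v ecc unfolding eccentricity_le_2_iff[OF v] by unfold_locales blast+
    show "\<exists>v\<in>pverts G. general_position_set (complementary_prism G) (prism_candidate G v)"
      using cut general_position_prism_candidateI[OF N] v unfolding card_cut_vertices_ge_2_iff by blast
  qed
qed

end
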